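(* In the setting of the context, assume $\lambda_{\min}(P)>0$. Then for every $(i,\alpha)\in\beth\times\aleph$ and every $n\ge0$, $$\|\psi_{i,\alpha}-\psi^n_{i,\alpha}\|\le\Big(\frac{\operatorname{Cond}(P)-1}{\operatorname{Cond}(P)+1}\Big)^n\|\psi^0_{i,\alpha}\|.$$
   Context: $(\mathcal B,\|\cdot\|)$ is a reflexive separable Banach space with dual $\mathcal B^*$ and pairing $[\cdot,\cdot]$, with $\|u\|^2=[Q^{-1}u,u]$ for a symmetric positive bijective linear operator $Q:\mathcal B^*\to\mathcal B$, and $\langle u,v\rangle:=[Q^{-1}u,v]$. $\aleph=\{1,\dots,|\aleph|\}$ and $\beth=\{1,\dots,|\beth|\}$ are finite index sets, and $(\phi_{i,\alpha})_{(i,\alpha)\in\beth\times\aleph}$ are linearly independent elements of $\mathcal B^*$. For $i\in\beth$, $\mathcal B_i\subset\mathcal B$ are closed subspaces (with the induced norm) such that (1) $\mathcal B=\mathcal B_1+\cdots+\mathcal B_{|\beth|}$ (not necessarily direct) and (2) for each $(i,\alpha)$ there is $\tilde\psi_{i,\alpha}\in\mathcal B_i$ with $[\phi_{j,\beta},\tilde\psi_{i,\alpha}]=\delta_{i,j}\delta_{\alpha,\beta}$ for all $(j,\beta)\in\beth\times\aleph$. $\mathfrak V^\perp:=\{\psi\in\mathcal B:[\phi_{i,\alpha},\psi]=0\ \forall(i,\alpha)\}$, $\mathfrak V^\perp_i:=\mathcal B_i\cap\mathfrak V^\perp$; $P_i$ is the $\langle\cdot,\cdot\rangle$-orthogonal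 projection of $\mathcal B$ onto $\mathfrak V^\perp_i$, $P:=\sum_{i\in\beth}P_i$. $\lambda_{\min}(P)$ and $\lambda_{\max}(P)$ are respectively the largest and smallest constants with $\lambda_{\min}(P)\|\chi\|^2\le\langle\chi,P\chi\rangle\le\lambda_{\max}(P)\|\chi\|^2$ for all $\chi\in\mathfrak V^\perp$; $\operatorname{Cond}(P):=\lambda_{\max}(P)/\lambda_{\min}(P)$. Let $\mathbf C_{i,j}=1$ if there exist $(\chi_i,\chi_j)\in\mathcal B_i\times\mathcal B_j$ with $\langle\chi_j,\chi_i\rangle\ne0$, and $\mathbf C_{i,j}=0$ otherwise. $\mathbf d(i,j)$ is the graph distance on $\beth$: the smallest $m$ such that there are $i_0=i,i_1,\dots,i_m=j$ with $\mathbf C_{i_{t-1},i_t}\ne0$ ($+\infty$ if none; $\mathbf d(i,j)=0$ iff $i=j$). $\mathcal B^n_i:=\sum_{j:\mathbf d(i,j)\le n}\mathcal B_j$. $\psi_{i,\alpha}$ is the minimizer of $\|\psi\|$ over $\psi\in\mathcal B$ with $[\phi_{j,\beta},\psi]=\delta_{i,j}\delta_{\alpha,\beta}$ for all $(j,\beta)\in\beth\times\aleph$; $\psi^n_{i,\alpha}$ is the minimizer of $\|\psi\|$ over $\psi\in\mathcal B^n_i$ with the same constraints.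
   Formalization: The bound is stated for those n, i, α for which the minimizer ψ^n_{i,α} over B^n_i exists; for n ≥ 1 the sum B^n_i of closed subspaces need not be closed, so the minimizer can fail to exist even when λ_min(P) > 0. *)

theory Defs
  imports "HOL-Analysis.Analysis"
begin

text \<open>
  The ambient space is a Banach space type \<open>'b\<close>; its dual is \<open>'b \<Rightarrow>\<^sub>L real\<close>, and the
  duality pairing of \<open>f\<close> and \<open>u\<close> is the application \<open>blinfun_apply f u\<close>.
  The norm comes from a bijection \<open>Q\<close> from the dual to the space.
\<close>

definition reflexive_space :: "'b::real_normed_vector itself \<Rightarrow> bool" where
  "reflexive_space _ \<longleftrightarrow>
    (\<forall>F :: ('b \<Rightarrow>\<^sub>L real) \<Rightarrow>\<^sub>L real. \<exists>u::'b. \<forall>f. blinfun_apply F f = blinfun_apply f u)"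

definition symmetric_positive_op :: "(('b::real_normed_vector \<Rightarrow>\<^sub>L real) \<Rightarrow> 'b) \<Rightarrow> bool" where
  "symmetric_positive_op Q \<longleftrightarrow>
    (\<forall>f g. blinfun_apply f (Q g) = blinfun_apply g (Q f)) \<and> (\<forall>f. 0 \<le> blinfun_apply f (Q f))"

definition Q_inner :: "(('b::real_normed_vector \<Rightarrow>\<^sub>L real) \<Rightarrow> 'b) \<Rightarrow> 'b \<Rightarrow> 'b \<Rightarrow> real" where
  "Q_inner Q u v = blinfun_apply (inv Q u) v"

definition orth_proj ::
  "(('b::real_normed_vector \<Rightarrow>\<^sub>L real) \<Rightarrow> 'b) \<Rightarrow> 'b set \<Rightarrow> 'b \<Rightarrow> 'b" where
  "orth_proj Q S x = (THE y. y \<in> S \<and> (\<forall>z\<in>S. Q_inner Q (x - y) z = 0))"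

text \<open>
  Below, \<open>I\<close> and \<open>A\<close> are the index sets \<open>\<beth>\<close> and \<open>\<aleph>\<close>, \<open>\<phi> i \<alpha>\<close> are the
  measurement functionals and \<open>\<B> i\<close> the local subspaces.
\<close>

definition V_perp ::
  "nat set \<Rightarrow> nat set \<Rightarrow> (nat \<Rightarrow> nat \<Rightarrow> ('b::real_normed_vector \<Rightarrow>\<^sub>L real)) \<Rightarrow> 'b set" where
  "V_perp I A \<phi> = {\<psi>. \<forall>i\<in>I. \<forall>\<alpha>\<in>A. blinfun_apply (\<phi> i \<alpha>) \<psi> = 0}"

definition subspace_op ::
  "(('b::real_normed_vector \<Rightarrow>\<^sub>L real) \<Rightarrow> 'b) \<Rightarrow> nat set \<Rightarrow> nat set
    \<Rightarrow> (nat \<Rightarrow> nat \<Rightarrow> ('b \<Rightarrow>\<^sub>L real)) \<Rightarrow> (nat \<Rightarrow> 'b set) \<Rightarrow> 'b \<Rightarrow> 'b" where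
  "subspace_op Q I A \<phi> \<B> v = (\<Sum>i\<in>I. orth_proj Q (\<B> i \<inter> V_perp I A \<phi>) v)"

text \<open>
  For an operator \<open>T\<close> on a subspace \<open>V\<close>. If \<open>V = {0}\<close>, every constant is admissible, no extremal
  one exists, and both values below are unspecified reals.
\<close>

definition lambda_min ::
  "(('b::real_normed_vector \<Rightarrow>\<^sub>L real) \<Rightarrow> 'b) \<Rightarrow> 'b set \<Rightarrow> ('b \<Rightarrow> 'b) \<Rightarrow> real" where
  "lambda_min Q V T = (GREATEST c. \<forall>v\<in>V. c * (norm v)\<^sup>2 \<le> Q_inner Q v (T v))"

definition lambda_max ::
  "(('b::real_normed_vector \<Rightarrow>\<^sub>L real) \<Rightarrow> 'b) \<Rightarrow> 'b set \<Rightarrow> ('b \<Rightarrow> 'b) \<Rightarrow> real" where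
  "lambda_max Q V T = (LEAST c. \<forall>v\<in>V. Q_inner Q v (T v) \<le> c * (norm v)\<^sup>2)"

definition Cond ::
  "(('b::real_normed_vector \<Rightarrow>\<^sub>L real) \<Rightarrow> 'b) \<Rightarrow> 'b set \<Rightarrow> ('b \<Rightarrow> 'b) \<Rightarrow> real" where
  "Cond Q V T = lambda_max Q V T / lambda_min Q V T"

definition conn ::
  "(('b::real_normed_vector \<Rightarrow>\<^sub>L real) \<Rightarrow> 'b) \<Rightarrow> (nat \<Rightarrow> 'b set) \<Rightarrow> nat \<Rightarrow> nat \<Rightarrow> nat" where
  "conn Q \<B> i j = (if \<exists>u\<in>\<B> i. \<exists>v\<in>\<B> j. Q_inner Q v u \<noteq> 0 then 1 else 0)"

text \<open>The infimum of the empty set in \<^typ>\<open>enat\<close> is \<open>\<infinity>\<close>.\<close>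

definition graph_dist ::
  "(('b::real_normed_vector \<Rightarrow>\<^sub>L real) \<Rightarrow> 'b) \<Rightarrow> nat set \<Rightarrow> (nat \<Rightarrow> 'b set)
    \<Rightarrow> nat \<Rightarrow> nat \<Rightarrow> enat" where
  "graph_dist Q I \<B> i j =
    Inf {enat m | m. \<exists>p. p 0 = i \<and> p m = j \<and> (\<forall>t\<le>m. p t \<in> I) \<and>
      (\<forall>t\<in>{1..m}. conn Q \<B> (p (t - 1)) (p t) \<noteq> 0)}"

text \<open>The sum below is the elementwise sum of sets from \<^theory>\<open>HOL-Library.Set_Algebras\<close>.\<close>

definition local_space ::
  "(('b::real_normed_vector \<Rightarrow>\<^sub>L real) \<Rightarrow> 'b) \<Rightarrow> nat set \<Rightarrow> (nat \<Rightarrow> 'b set)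
    \<Rightarrow> nat \<Rightarrow> nat \<Rightarrow> 'b set" where
  "local_space Q I \<B> n i = (\<Sum>j \<in> {j\<in>I. graph_dist Q I \<B> i j \<le> enat n}. \<B> j)"

definition admissible ::
  "nat set \<Rightarrow> nat set \<Rightarrow> (nat \<Rightarrow> nat \<Rightarrow> ('b::real_normed_vector \<Rightarrow>\<^sub>L real)) \<Rightarrow> 'b set
    \<Rightarrow> nat \<Rightarrow> nat \<Rightarrow> 'b set" where
  "admissible I A \<phi> S i \<alpha> =
    {\<psi>\<in>S. \<forall>j\<in>I. \<forall>\<beta>\<in>A. blinfun_apply (\<phi> j \<beta>) \<psi> = (if i = j \<and> \<alpha> = \<beta> then 1 else 0)}"

definition psi ::
  "nat set \<Rightarrow> nat set \<Rightarrow> (nat \<Rightarrow> nat \<Rightarrow> ('b::real_normed_vector \<Rightarrow>\<^sub>L real))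
    \<Rightarrow> nat \<Rightarrow> nat \<Rightarrow> 'b" where
  "psi I A \<phi> i \<alpha> = arg_min_on norm (admissible I A \<phi> UNIV i \<alpha>)"

definition psi_loc ::
  "(('b::real_normed_vector \<Rightarrow>\<^sub>L real) \<Rightarrow> 'b) \<Rightarrow> nat set \<Rightarrow> nat set
    \<Rightarrow> (nat \<Rightarrow> nat \<Rightarrow> ('b \<Rightarrow>\<^sub>L real)) \<Rightarrow> (nat \<Rightarrow> 'b set) \<Rightarrow> nat \<Rightarrow> nat \<Rightarrow> nat \<Rightarrow> 'b" where
  "psi_loc Q I A \<phi> \<B> n i \<alpha> = arg_min_on norm (admissible I A \<phi> (local_space Q I \<B> n i) i \<alpha>)"

text \<open>
  A sum of closed subspaces need not be closed, so for \<open>n \<ge> 1\<close> the minimizer over the local space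
  is not guaranteed to exist, and \<^const>\<open>psi_loc\<close> is unspecified if it does not.
\<close>

definition psi_loc_exists ::
  "(('b::real_normed_vector \<Rightarrow>\<^sub>L real) \<Rightarrow> 'b) \<Rightarrow> nat set \<Rightarrow> nat set
    \<Rightarrow> (nat \<Rightarrow> nat \<Rightarrow> ('b \<Rightarrow>\<^sub>L real)) \<Rightarrow> (nat \<Rightarrow> 'b set) \<Rightarrow> nat \<Rightarrow> nat \<Rightarrow> nat \<Rightarrow> bool" where
  "psi_loc_exists Q I A \<phi> \<B> n i \<alpha> \<longleftrightarrow>
    (\<exists>\<psi>. is_arg_min norm (\<lambda>\<psi>. \<psi> \<in> admissible I A \<phi> (local_space Q I \<B> n i) i \<alpha>) \<psi>)"

end

theory Submission
  imports Defs
begin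

text \<open>
  Write \<open>x\<^sub>0 = \<psi>\<^sup>0\<close> and \<open>x\<^sub>k\<^sub>+\<^sub>1 = x\<^sub>k - \<tau> P x\<^sub>k\<close> with \<open>\<tau> = 2 / (\<lambda>\<^sub>m\<^sub>i\<^sub>n + \<lambda>\<^sub>m\<^sub>a\<^sub>x)\<close>. Since \<open>\<psi>\<close> is orthogonal
  to \<open>V\<^sup>\<bottom>\<close>, each \<open>P\<^sub>j\<close> annihilates it, so the errors satisfy
  \<open>x\<^sub>k\<^sub>+\<^sub>1 - \<psi> = (1 - \<tau> P) (x\<^sub>k - \<psi>)\<close> and contract by the factor \<open>(Cond - 1) / (Cond + 1)\<close>. One application
  of \<open>P\<close> enlarges the support by one step of the graph, so \<open>x\<^sub>n\<close> is admissible for the problem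
  defining \<open>\<psi>\<^sup>n\<close>. By Pythagoras, \<open>\<psi>\<^sup>n\<close> is also the admissible element closest to \<open>\<psi>\<close>, hence at
  least as close as \<open>x\<^sub>n\<close>.
\<close>

section \<open>Hilbert spaces given by a form on a Banach space\<close>

text \<open>Positive definiteness is contained in \<open>norm_sq\<close>, and completeness in the
  type class \<open>banach\<close>, so these axioms describe a real Hilbert space whose norm is the
  given one.\<close>

locale hilbert_form =
  fixes ip :: "'b::banach \<Rightarrow> 'b \<Rightarrow> real"
  assumes add_left: "ip (x + y) z = ip x z + ip y z"
    and scaleR_left: "ip (c *\<^sub>R x) z = c * ip x z"
    and commute: "ip x y = ip y x"
    and norm_sq: "(norm x)\<^sup>2 = ip x x"
begin

lemma add_right: "ip z (x + y) = ip z x + ip z y"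
  unfolding commute[of z "x + y"] commute[of z x] commute[of z y] by (rule add_left)

lemma scaleR_right: "ip z (c *\<^sub>R x) = c * ip z x"
  unfolding commute[of z "c *\<^sub>R x"] commute[of z x] by (rule scaleR_left)

lemma minus_left: "ip (- x) z = - ip x z"
  using scaleR_left[of "-1" x z] by simp

lemma minus_right: "ip z (- x) = - ip z x"
  using scaleR_right[of z "-1" x] by simp

lemma diff_left: "ip (x - y) z = ip x z - ip y z"
  using add_left[of x "- y" z] by (simp add: minus_left)

lemma diff_right: "ip z (x - y) = ip z x - ip z y"
  using add_right[of z x "- y"] by (simp add: minus_right)

lemma zero_left [simp]: "ip 0 z = 0"
  using scaleR_left[of 0 0 z] by simp

lemma zero_right [simp]: "ip z 0 = 0"
  using scaleR_right[of z 0 0] by simp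

lemma sum_left: "ip (\<Sum>j\<in>J. f j) z = (\<Sum>j\<in>J. ip (f j) z)"
  by (induction J rule: infinite_finite_induct) (auto simp: add_left)

lemma sum_right: "ip z (\<Sum>j\<in>J. f j) = (\<Sum>j\<in>J. ip z (f j))"
  by (induction J rule: infinite_finite_induct) (auto simp: add_right)

lemmas ip_simps = add_left add_right diff_left diff_right scaleR_left scaleR_right

section \<open>Minimal norm and orthogonal projection\<close>

lemma parallelogram:
  fixes x y :: 'b
  shows "(norm (x + y))\<^sup>2 + (norm (x - y))\<^sup>2 = 2 * (norm x)\<^sup>2 + 2 * (norm y)\<^sup>2"
  by (simp add: norm_sq ip_simps)

lemma pythagoras: "ip x y = 0 \<Longrightarrow> (norm (x + y))\<^sup>2 = (norm x)\<^sup>2 + (norm y)\<^sup>2"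
  using commute[of x y] by (simp add: norm_sq ip_simps)

text \<open>By the parallelogram law a minimizing sequence is Cauchy, and its limit stays in the
  closed set. Only midpoints enter that law, so closure under midpoints stands in for
  convexity.\<close>

lemma norm_minimizer_exists:
  fixes S :: "'b set"
  assumes "closed S" "S \<noteq> {}"
    and mid: "\<And>x y. x \<in> S \<Longrightarrow> y \<in> S \<Longrightarrow> (1/2) *\<^sub>R (x + y) \<in> S"
  shows "\<exists>x\<in>S. \<forall>y\<in>S. norm x \<le> norm y"
proof -
  define d where "d = (INF x\<in>S. (norm x)\<^sup>2)"
  have bdd: "bdd_below ((\<lambda>x. (norm x)\<^sup>2) ` S)"
    by (rule bdd_belowI[of _ 0]) auto
  have low: "d \<le> (norm x)\<^sup>2" if "x \<in> S" for x
    unfolding d_def using bdd that by (rule cINF_lower)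
  have "\<exists>x\<in>S. (norm x)\<^sup>2 < d + 1 / Suc k" for k
  proof -
    have "d < d + 1 / Suc k" by simp
    then show ?thesis
      unfolding d_def using cINF_less_iff[OF assms(2) bdd] by blast
  qed
  then obtain x where xS: "x k \<in> S" and x_less: "(norm (x k))\<^sup>2 < d + 1 / Suc k" for k
    by metis
  \<comment> \<open>The squared distance is twice the two squared norms minus four times the squared
    norm of the midpoint. The midpoint lies in \<open>S\<close>, so the last term is at least
    \<open>4 * d\<close> and all multiples of \<open>d\<close> cancel.\<close>
  have close: "(norm (x k - x l))\<^sup>2 \<le> 2 / Suc k + 2 / Suc l" for k l
  proof -
    have "d \<le> (norm ((1/2) *\<^sub>R (x k + x l)))\<^sup>2"
      using low mid xS by blast
    then have "4 * d \<le> (norm (x k + x l))\<^sup>2"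
      by (simp add: power_mult_distrib power_divide)
    then show ?thesis
      using parallelogram[of "x k" "x l"] x_less[of k] x_less[of l] by simp
  qed
  have "Cauchy x"
  proof (rule metric_CauchyI)
    fix e :: real assume e: "e > 0"
    obtain N :: nat where "4 / e\<^sup>2 < N"
      using reals_Archimedean2 by blast
    then have N: "4 / e\<^sup>2 < Suc N" by simp
    have "dist (x k) (x l) < e" if "k \<ge> N" "l \<ge> N" for k l
    proof -
      have "2 / Suc k + 2 / Suc l \<le> 2 / Suc N + 2 / real (Suc N)"
        using that by (intro add_mono divide_left_mono) auto
      also have "\<dots> = 4 / real (Suc N)" by simp
      also have "\<dots> < e\<^sup>2"
        using N e by (simp add: pos_divide_less_eq mult.commute)
      finally have "(norm (x k - x l))\<^sup>2 < e\<^sup>2"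
        using close[of k l] by linarith
      then show ?thesis
        using e by (simp add: dist_norm power_less_imp_less_base)
    qed
    then show "\<exists>N. \<forall>k\<ge>N. \<forall>l\<ge>N. dist (x k) (x l) < e" by blast
  qed
  then obtain L where L: "x \<longlonglongrightarrow> L"
    using Cauchy_convergent_iff convergent_def by blast
  have "L \<in> S"
    using closed_sequentially[OF assms(1) _ L] xS by blast
  moreover have "(norm L)\<^sup>2 \<le> d"
  proof (rule LIMSEQ_le)
    show "(\<lambda>k. (norm (x k))\<^sup>2) \<longlonglongrightarrow> (norm L)\<^sup>2"
      by (intro tendsto_intros L)
    show "(\<lambda>k. d + 1 / Suc k) \<longlonglongrightarrow> d"
      using tendsto_add[OF tendsto_const LIMSEQ_inverse_real_of_nat, of d]
      by (simp add: inverse_eq_divide)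
    show "\<exists>N. \<forall>k\<ge>N. (norm (x k))\<^sup>2 \<le> d + 1 / Suc k"
      using x_less less_imp_le by blast
  qed
  then have "norm L \<le> norm y" if "y \<in> S" for y
    using low[OF that] by (meson norm_ge_zero order_trans power2_le_imp_le)
  ultimately show ?thesis by blast
qed

text \<open>The squared norm of \<open>x + t *\<^sub>R w\<close> is a quadratic polynomial in
  \<open>t\<close>. At its vertex it lies below its value at 0 by
  \<open>(ip x w)\<^sup>2 / ip w w\<close>, which minimality forces to vanish.\<close>

lemma orthogonal_if_minimal:
  assumes "\<And>t. norm x \<le> norm (x + t *\<^sub>R w)"
  shows "ip x w = 0"
proof (cases "w = 0")
  case False
  define t where "t = - ip x w / ip w w"
  have pos: "ip w w > 0"
    using False by (simp flip: norm_sq)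
  have "(norm x)\<^sup>2 \<le> (norm (x + t *\<^sub>R w))\<^sup>2"
    using assms by (intro power_mono) auto
  also have "\<dots> = (norm x)\<^sup>2 + 2 * t * ip x w + t\<^sup>2 * ip w w"
    using commute[of w x] by (simp add: norm_sq ip_simps) (simp add: power2_eq_square distrib_left)
  also have "\<dots> = (norm x)\<^sup>2 - (ip x w)\<^sup>2 / ip w w"
    using pos by (simp add: t_def power2_eq_square field_simps)
  finally show ?thesis
    using pos by (simp add: divide_le_0_iff)
qed simp

text \<open>This gives meaning to the \<open>THE\<close> in \<open>orth_proj\<close>. Existence
  comes from the element of least norm in the translate of \<open>S\<close> by \<open>x\<close>,
  uniqueness from the fact that two candidates differ by a vector of \<open>S\<close> orthogonal to
  itself.\<close>

lemma projection_ex1: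
  assumes "closed S" "subspace S"
  shows "\<exists>!y. y \<in> S \<and> (\<forall>z\<in>S. ip (x - y) z = 0)"
proof (rule ex_ex1I)
  have cl: "closed ((\<lambda>y. x - y) ` S)"
    using closed_translation[OF closed_negations[OF assms(1)], of x]
    by (simp add: image_image)
  have mid: "(1/2) *\<^sub>R (u + v) \<in> (\<lambda>y. x - y) ` S"
    if uv: "u \<in> (\<lambda>y. x - y) ` S" "v \<in> (\<lambda>y. x - y) ` S" for u v
  proof -
    obtain a b where ab: "a \<in> S" "b \<in> S" "u = x - a" "v = x - b" using uv by blast
    have "(1/2) *\<^sub>R (u + v) = x - (1/2) *\<^sub>R (a + b)"
      using ab scaleR_half_double[of x] by (simp add: scaleR_diff_right scaleR_add_right)
    then show ?thesis
      using ab assms(2) by (auto intro!: imageI simp: subspace_add subspace_scale)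
  qed
  have ne: "(\<lambda>y. x - y) ` S \<noteq> {}"
    using assms(2) by (auto simp: subspace_def)
  obtain y where y: "y \<in> S" "\<And>z. z \<in> S \<Longrightarrow> norm (x - y) \<le> norm (x - z)"
    using norm_minimizer_exists[OF cl ne mid] by blast
  have "ip (x - y) z = 0" if "z \<in> S" for z
  proof (rule orthogonal_if_minimal)
    fix t
    have "y - t *\<^sub>R z \<in> S"
      using y(1) that assms(2) by (simp add: subspace_diff subspace_scale)
    from y(2)[OF this] show "norm (x - y) \<le> norm (x - y + t *\<^sub>R z)"
      by (simp add: algebra_simps)
  qed
  then show "\<exists>y. y \<in> S \<and> (\<forall>z\<in>S. ip (x - y) z = 0)"
    using y(1) by blast
next
  fix y y' assume y: "y \<in> S \<and> (\<forall>z\<in>S. ip (x - y) z = 0)" and y': "y' \<in> S \<and> (\<forall>z\<in>S. ip (x - y') z = 0)"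
  have "y - y' \<in> S" using y y' assms(2) by (simp add: subspace_diff)
  then have "ip (x - y') (y - y') - ip (x - y) (y - y') = 0" using y y' by simp
  then have "(norm (y - y'))\<^sup>2 = 0"
    by (simp add: norm_sq ip_simps)
  then show "y = y'" by simp
qed

text \<open>As in the next two lemmas, \<open>p\<close> is any map with the two characteristic
  properties of the projection. The right side is symmetric in \<open>x\<close> and
  \<open>y\<close>, which later yields self-adjointness.\<close>

lemma projection_ip:
  assumes "\<And>x. p x \<in> S" "\<And>x z. z \<in> S \<Longrightarrow> ip (x - p x) z = 0"
  shows "ip x (p y) = ip (p x) (p y)"
  using assms(2)[of "p y" x] assms(1) by (simp add: diff_left)

lemma projection_norm_le:
  assumes "\<And>x. p x \<in> S" "\<And>x z. z \<in> S \<Longrightarrow> ip (x - p x) z = 0"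
  shows "norm (p x) \<le> norm x"
proof -
  have "ip (x - p x) (p x) = 0" using assms by blast
  from pythagoras[OF this] have "(norm (p x))\<^sup>2 \<le> (norm x)\<^sup>2" by simp
  then show ?thesis by (rule power2_le_imp_le) simp
qed

text \<open>The defects of additivity and homogeneity lie in \<open>S\<close> and are orthogonal to
  \<open>S\<close>, hence vanish.\<close>

lemma projection_linear:
  assumes "subspace S" "\<And>x. p x \<in> S" "\<And>x z. z \<in> S \<Longrightarrow> ip (x - p x) z = 0"
  shows "linear p"
proof -
  have eqI: "u = 0" if "u \<in> S" "ip u u = 0" for u
    using that norm_sq[of u] by simp
  show ?thesis
  proof (rule linearI)
    fix x y :: 'b and c :: real
    let ?u = "p (x + y) - (p x + p y)"
    have u: "?u \<in> S" using assms(1,2) by (simp add: subspace_diff subspace_add)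
    have "ip ?u ?u = 0"
      using assms(3)[OF u, of x] assms(3)[OF u, of y] assms(3)[OF u, of "x + y"]
      by (simp add: diff_left add_left)
    with u show "p (x + y) = p x + p y" using eqI[of ?u] by simp
    let ?v = "p (c *\<^sub>R x) - c *\<^sub>R p x"
    have v: "?v \<in> S" using assms(1,2) by (simp add: subspace_diff subspace_scale)
    have "ip ?v ?v = c * ip (x - p x) ?v - ip (c *\<^sub>R x - p (c *\<^sub>R x)) ?v"
      by (simp add: diff_left scaleR_left right_diff_distrib)
    then have "ip ?v ?v = 0"
      using assms(3)[OF v, of x] assms(3)[OF v, of "c *\<^sub>R x"] by simp
    with v show "p (c *\<^sub>R x) = c *\<^sub>R p x" using eqI[of ?v] by simp
  qed
qed

text \<open>For a symmetric operator the quadratic form controls the operator norm: polarization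
  writes \<open>ip (S v) w\<close> through the values of the form at \<open>v + w\<close> and
  \<open>v - w\<close>.\<close>

lemma norm_le_of_quadratic_form_bound:
  assumes V: "subspace V" and S: "linear S" "\<And>v. v \<in> V \<Longrightarrow> S v \<in> V"
    and sym: "\<And>v w. v \<in> V \<Longrightarrow> w \<in> V \<Longrightarrow> ip (S v) w = ip v (S w)"
    and bound: "\<And>v. v \<in> V \<Longrightarrow> \<bar>ip v (S v)\<bar> \<le> r * (norm v)\<^sup>2"
    and v: "v \<in> V"
  shows "norm (S v) \<le> r * norm v"
proof (cases "v = 0 \<or> S v = 0")
  case True
  \<comment> \<open>The sign of \<open>r\<close> is not assumed; the bound at a nonzero
    \<open>v\<close> implies it.\<close>
  have "0 \<le> r * norm v" if "v \<noteq> 0"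
    using order_trans[OF abs_ge_zero bound[OF v]] that
    by (simp add: zero_le_mult_iff)
  then show ?thesis using True linear_0[OF S(1)] by (cases "v = 0") auto
next
  case False
  \<comment> \<open>Rescaling \<open>S v\<close> to the length of \<open>v\<close> makes the
    parallelogram law return exactly \<open>4 * (norm v)\<^sup>2\<close>, while
    \<open>ip (S v) w\<close> becomes \<open>norm v * norm (S v)\<close>.\<close>
  define w where "w = (norm v / norm (S v)) *\<^sub>R S v"
  have w: "w \<in> V" using S(2)[OF v] V by (simp add: w_def subspace_scale)
  have nw: "norm w = norm v" using False by (simp add: w_def)
  have "4 * ip (S v) w = ip (v + w) (S (v + w)) - ip (v - w) (S (v - w))"
    using sym[OF v w] sym[OF w v] commute[of "S v" w] commute[of "S w" v]
    by (simp add: linear_add[OF S(1)] linear_diff[OF S(1)] ip_simps)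
  also have "\<dots> \<le> r * (norm (v + w))\<^sup>2 + r * (norm (v - w))\<^sup>2"
    using bound[OF subspace_add[OF V v w]] bound[OF subspace_diff[OF V v w]] by linarith
  also have "\<dots> = 4 * (r * (norm v)\<^sup>2)"
    using parallelogram[of v w] nw by (simp flip: distrib_left)
  finally have "ip (S v) w \<le> r * (norm v)\<^sup>2" by simp
  moreover have "ip (S v) w = norm v * norm (S v)"
    using False by (simp add: w_def scaleR_right power2_eq_square flip: norm_sq)
  ultimately show ?thesis
    using False by (simp add: power2_eq_square)
qed

text \<open>The factor \<open>2 / (m + M)\<close> sends the interval from \<open>m\<close> to
  \<open>M\<close>, which bounds the form of \<open>P\<close>, to one symmetric about 0 with radius
  \<open>(M - m) / (M + m)\<close>. The preceding lemma turns this bound on the form into one on the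
  norm.\<close>

lemma richardson_contraction:
  assumes V: "subspace V" and P: "linear P" "\<And>v. v \<in> V \<Longrightarrow> P v \<in> V"
    and sym: "\<And>v w. ip (P v) w = ip v (P w)"
    and lower: "\<And>v. v \<in> V \<Longrightarrow> m * (norm v)\<^sup>2 \<le> ip v (P v)"
    and upper: "\<And>v. v \<in> V \<Longrightarrow> ip v (P v) \<le> M * (norm v)\<^sup>2"
    and m: "0 < m" "m \<le> M" and v: "v \<in> V"
  shows "norm (v - (2 / (m + M)) *\<^sub>R P v) \<le> (M - m) / (M + m) * norm v"
proof (rule norm_le_of_quadratic_form_bound[where S = "\<lambda>v. v - (2 / (m + M)) *\<^sub>R P v", OF V _ _ _ _ v])
  show "linear (\<lambda>v. v - (2 / (m + M)) *\<^sub>R P v)"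
    using P(1) by (intro linear_compose_sub linear_ident linear_compose_scale_right)
  show "u - (2 / (m + M)) *\<^sub>R P u \<in> V" if "u \<in> V" for u
    using that V P(2) by (simp add: subspace_diff subspace_scale)
  show "ip (u - (2 / (m + M)) *\<^sub>R P u) w = ip u (w - (2 / (m + M)) *\<^sub>R P w)" for u w
    by (simp add: ip_simps sym)
  fix u assume u: "u \<in> V"
  have "\<bar>(m + M) * (norm u)\<^sup>2 - 2 * ip u (P u)\<bar> \<le> (M - m) * (norm u)\<^sup>2"
    using lower[OF u] upper[OF u] by (simp add: abs_le_iff algebra_simps)
  moreover have "ip u (u - (2 / (m + M)) *\<^sub>R P u) = ((m + M) * (norm u)\<^sup>2 - 2 * ip u (P u)) / (m + M)"
    using m by (simp add: ip_simps norm_sq field_simps)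
  ultimately show "\<bar>ip u (u - (2 / (m + M)) *\<^sub>R P u)\<bar> \<le> (M - m) / (M + m) * (norm u)\<^sup>2"
    using m by (simp add: abs_divide divide_right_mono add.commute)
qed

end

text \<open>Linearity of \<open>inv Q\<close> follows by applying it to \<open>Q\<close> of the
  expected value; symmetry is that of \<open>Q\<close> at the functionals \<open>inv Q x\<close> and
  \<open>inv Q y\<close>.\<close>

lemma hilbert_form_Q_inner:
  fixes Q :: "('b::banach \<Rightarrow>\<^sub>L real) \<Rightarrow> 'b"
  assumes "linear Q" "bij Q" "symmetric_positive_op Q"
    and "\<And>u. (norm u)\<^sup>2 = blinfun_apply (inv Q u) u"
  shows "hilbert_form (Q_inner Q)"
proof
  have Q_inv: "Q (inv Q u) = u" for u
    using assms(2) by (simp add: bij_is_surj surj_f_inv_f)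
  have inv_Q: "inv Q (Q f) = f" for f
    using assms(2) by (simp add: bij_is_inj)
  fix x y z :: 'b and c :: real
  have "inv Q (x + y) = inv Q x + inv Q y"
    using inv_Q[of "inv Q x + inv Q y"] by (simp add: linear_add[OF assms(1)] Q_inv)
  then show "Q_inner Q (x + y) z = Q_inner Q x z + Q_inner Q y z"
    by (simp add: Q_inner_def blinfun.add_left)
  have "inv Q (c *\<^sub>R x) = c *\<^sub>R inv Q x"
    using inv_Q[of "c *\<^sub>R inv Q x"] by (simp add: linear_scale[OF assms(1)] Q_inv)
  then show "Q_inner Q (c *\<^sub>R x) z = c * Q_inner Q x z"
    by (simp add: Q_inner_def blinfun.scaleR_left)
  have "blinfun_apply f (Q g) = blinfun_apply g (Q f)" for f g
    using assms(3) by (simp add: symmetric_positive_op_def)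
  from this[of "inv Q x" "inv Q y"] show "Q_inner Q x y = Q_inner Q y x"
    by (simp add: Q_inner_def Q_inv)
  show "(norm x)\<^sup>2 = Q_inner Q x x"
    by (simp add: Q_inner_def assms(4))
qed

section \<open>Extremal constants\<close>

text \<open>\<open>GREATEST\<close> is meaningful only if the maximum is attained. The set of
  constants contains 0, is bounded above by the quotient at \<open>v\<^sub>0\<close>, and its
  supremum again satisfies every constraint.\<close>

lemma Greatest_lower_constant:
  fixes q w :: "'a \<Rightarrow> real"
  assumes "\<And>v. v \<in> V \<Longrightarrow> 0 \<le> w v" "\<And>v. v \<in> V \<Longrightarrow> 0 \<le> q v" "v\<^sub>0 \<in> V" "0 < w v\<^sub>0" "v \<in> V"
  shows "(GREATEST c. \<forall>v\<in>V. c * w v \<le> q v) * w v \<le> q v"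
proof -
  define C where "C = {c. \<forall>v\<in>V. c * w v \<le> q v}"
  have le: "c \<le> q v / w v" if "c \<in> C" "v \<in> V" "0 < w v" for c v
    using that by (simp add: C_def pos_le_divide_eq)
  have "0 \<in> C" using assms(2) by (simp add: C_def)
  then have "Sup C * w v \<le> q v" if "v \<in> V" for v
  proof (cases "w v = 0")
    case False
    then have "0 < w v" using assms(1)[OF that] by simp
    moreover have "Sup C \<le> q v / w v"
      using \<open>0 \<in> C\<close> le[OF _ that \<open>0 < w v\<close>] by (intro cSup_least) auto
    ultimately show ?thesis by (simp add: pos_le_divide_eq)
  qed (use assms(2) that in auto)
  moreover have "c \<le> Sup C" if "c \<in> C" for c
    using that le[OF _ assms(3,4)] by (meson bdd_aboveI cSup_upper)
  ultimately have "(GREATEST c. \<forall>v\<in>V. c * w v \<le> q v) = Sup C"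
    by (intro Greatest_equality) (auto simp: C_def)
  then show ?thesis
    using \<open>\<And>v. v \<in> V \<Longrightarrow> Sup C * w v \<le> q v\<close> assms(5) by simp
qed

text \<open>The mirror image for \<open>LEAST\<close>: \<open>K\<close> makes the set of constants
  nonempty, \<open>v\<^sub>0\<close> bounds it below, and the infimum is attained.\<close>

lemma Least_upper_constant:
  fixes q w :: "'a \<Rightarrow> real"
  assumes "\<And>v. v \<in> V \<Longrightarrow> 0 \<le> w v" "\<And>v. v \<in> V \<Longrightarrow> q v \<le> K * w v" "v\<^sub>0 \<in> V" "0 < w v\<^sub>0" "v \<in> V"
  shows "q v \<le> (LEAST c. \<forall>v\<in>V. q v \<le> c * w v) * w v"
proof -
  define C where "C = {c. \<forall>v\<in>V. q v \<le> c * w v}"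
  have le: "q v / w v \<le> c" if "c \<in> C" "v \<in> V" "0 < w v" for c v
    using that by (simp add: C_def pos_divide_le_eq)
  have K: "K \<in> C" using assms(2) by (simp add: C_def)
  have upper: "q v \<le> Inf C * w v" if "v \<in> V" for v
  proof (cases "w v = 0")
    case False
    then have "0 < w v" using assms(1)[OF that] by simp
    moreover have "q v / w v \<le> Inf C"
      using K le[OF _ that \<open>0 < w v\<close>] by (intro cInf_greatest) auto
    ultimately show ?thesis by (simp add: pos_divide_le_eq)
  qed (use assms(2)[OF that] in auto)
  moreover have "Inf C \<le> c" if "c \<in> C" for c
    using that le[OF _ assms(3,4)] by (meson bdd_belowI cInf_lower)
  ultimately have "(LEAST c. \<forall>v\<in>V. q v \<le> c * w v) = Inf C"
    by (intro Least_equality) (auto simp: C_def)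
  then show ?thesis using upper assms(5) by simp
qed

text \<open>If \<open>V = {0}\<close>, both \<open>GREATEST\<close> and \<open>LEAST\<close> unfold to the same junk value \<open>THE c. False\<close>.\<close>

lemma lambda_max_eq_lambda_min_trivial: "lambda_max Q {0} T = lambda_min Q {0} T"
  if "Q_inner Q 0 (T 0) = 0" for T :: "'b::real_normed_vector \<Rightarrow> 'b"
proof -
  have "(\<exists>y::real. y < x)" "(\<exists>y. x < y)" for x by (rule lt_ex, rule gt_ex)
  then have "(\<lambda>x::real. \<forall>y. x \<le> y) = (\<lambda>x. False)" "(\<lambda>x::real. \<forall>y. y \<le> x) = (\<lambda>x. False)"
    by (meson not_le)+
  then show ?thesis
    unfolding lambda_max_def lambda_min_def Least_def Greatest_def by (simp add: that)
qed

section \<open>Graph distance and local spaces\<close>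

text \<open>Distances are integers, so if every one exceeds \<open>n\<close>, then
  \<open>Suc n\<close> is a lower bound of the set. This includes the empty set, whose infimum is
  infinite.\<close>

lemma Inf_enat_le_iff: "Inf {enat m | m. P m} \<le> enat n \<longleftrightarrow> (\<exists>m\<le>n. P m)"
proof
  assume le: "Inf {enat m | m. P m} \<le> enat n"
  show "\<exists>m\<le>n. P m"
  proof (rule ccontr)
    assume "\<not> ?thesis"
    then have "enat (Suc n) \<le> Inf {enat m | m. P m}"
      by (intro Inf_greatest) (auto simp: not_le Suc_le_eq intro: leI)
    then have "enat (Suc n) \<le> enat n" using le by (rule order_trans)
    then show False by simp
  qed
next
  assume "\<exists>m\<le>n. P m"
  then show "Inf {enat m | m. P m} \<le> enat n"
    by (auto intro!: Inf_lower2)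
qed

lemma graph_dist_le_iff:
  "graph_dist Q I \<B> i j \<le> enat n \<longleftrightarrow>
    (\<exists>m\<le>n. \<exists>p. p 0 = i \<and> p m = j \<and> (\<forall>t\<le>m. p t \<in> I) \<and>
      (\<forall>t\<in>{1..m}. conn Q \<B> (p (t - 1)) (p t) \<noteq> 0))"
  unfolding graph_dist_def by (rule Inf_enat_le_iff)

lemma graph_dist_le_0_iff: "i \<in> I \<Longrightarrow> graph_dist Q I \<B> i j \<le> enat 0 \<longleftrightarrow> i = j"
  unfolding graph_dist_le_iff by (auto intro!: exI[of _ "\<lambda>_. j"])

lemma graph_dist_le_Suc:
  assumes "graph_dist Q I \<B> i j \<le> enat n" "k \<in> I" "conn Q \<B> j k \<noteq> 0"
  shows "graph_dist Q I \<B> i k \<le> enat (Suc n)"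
proof -
  obtain m p where p: "m \<le> n" "p 0 = i" "p m = j" "\<forall>t\<le>m. p t \<in> I"
    "\<forall>t\<in>{1..m}. conn Q \<B> (p (t - 1)) (p t) \<noteq> 0"
    using assms(1) unfolding graph_dist_le_iff by blast
  show ?thesis
    unfolding graph_dist_le_iff
    \<comment> \<open>The walk to \<open>j\<close> is prolonged by the single step to
      \<open>k\<close>.\<close>
    using p assms(2,3) by (intro exI[of _ "Suc m"] conjI exI[of _ "p(Suc m := k)"]) (auto simp: le_Suc_eq)
qed

section \<open>Sums of subspaces and nesting of local spaces\<close>

lemma subspace_set_sum:
  assumes "\<And>j. j \<in> J \<Longrightarrow> subspace (B j)"
  shows "subspace (\<Sum>j\<in>J. B j)"
  using assms
proof (induction J rule: infinite_finite_induct)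
  case (insert j J)
  then show ?case
    using subspace_sums[of "B j" "\<Sum>j\<in>J. B j"]
    by (simp add: set_plus_def) (simp add: Bex_def conj_ac)
qed (simp_all add: set_zero subspace_0)

lemma subset_set_sum:
  fixes B :: "'i \<Rightarrow> 'b::real_vector set"
  assumes "finite J" "j \<in> J" "\<And>k. k \<in> J \<Longrightarrow> subspace (B k)"
  shows "B j \<subseteq> (\<Sum>k\<in>J. B k)"
proof
  fix x assume "x \<in> B j"
  then show "x \<in> (\<Sum>k\<in>J. B k)"
    using assms unfolding set_sum_alt[OF assms(1)]
    by (auto intro!: exI[of _ "\<lambda>k. if k = j then x else 0"] simp: subspace_0)
qed

lemma local_space_0: "i \<in> I \<Longrightarrow> local_space Q I \<B> 0 i = \<B> i"
proof -
  assume "i \<in> I"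
  then have "{j\<in>I. graph_dist Q I \<B> i j \<le> enat 0} = {i}"
    by (auto simp: graph_dist_le_0_iff)
  then show ?thesis by (simp add: local_space_def)
qed

lemma local_space_mono:
  assumes "finite I" "\<And>j. j \<in> I \<Longrightarrow> subspace (\<B> j)" "m \<le> n"
  shows "local_space Q I \<B> m i \<subseteq> local_space Q I \<B> n i"
proof
  let ?J = "\<lambda>n. {j\<in>I. graph_dist Q I \<B> i j \<le> enat n}"
  fix x assume "x \<in> local_space Q I \<B> m i"
  then obtain s where s: "x = sum s (?J m)" "\<forall>j\<in>?J m. s j \<in> \<B> j"
    using assms(1) by (auto simp: local_space_def set_sum_alt)
  have sub: "?J m \<subseteq> ?J n"
    using assms(3) by (auto intro: order_trans)
  have "s j \<in> (\<Sum>j\<in>?J n. \<B> j)" if "j \<in> ?J m" for j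
  proof -
    have "\<B> j \<subseteq> (\<Sum>j\<in>?J n. \<B> j)"
      using that sub assms(1,2) by (intro subset_set_sum) auto
    then show ?thesis using s(2) that by blast
  qed
  moreover have "subspace (\<Sum>j\<in>?J n. \<B> j)"
    using assms(2) by (intro subspace_set_sum) auto
  ultimately have "x \<in> (\<Sum>j\<in>?J n. \<B> j)"
    unfolding s(1) by (intro subspace_sum)
  then show "x \<in> local_space Q I \<B> n i"
    by (simp add: local_space_def)
qed

section \<open>Constraint sets as closed affine spaces\<close>

lemma subspace_V_perp: "subspace (V_perp I A \<phi>)"
  by (auto simp: subspace_def V_perp_def blinfun.add_right blinfun.scaleR_right)

lemma closed_V_perp: "closed (V_perp I A \<phi>)"
proof -
  have "V_perp I A \<phi> = (\<Inter>i\<in>I. \<Inter>\<alpha>\<in>A. {\<psi>. blinfun_apply (\<phi> i \<alpha>) \<psi> = 0})"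
    by (auto simp: V_perp_def)
  then show ?thesis
    by (auto intro!: closed_INT closed_Collect_eq continuous_intros)
qed

lemma admissible_add:
  assumes "subspace S" "x \<in> admissible I A \<phi> S i \<alpha>" "v \<in> S" "v \<in> V_perp I A \<phi>"
  shows "x + v \<in> admissible I A \<phi> S i \<alpha>"
  using assms by (auto simp: admissible_def V_perp_def blinfun.add_right subspace_add)

lemma admissible_diff:
  assumes "x \<in> admissible I A \<phi> S i \<alpha>" "y \<in> admissible I A \<phi> T i \<alpha>"
  shows "x - y \<in> V_perp I A \<phi>"
  using assms by (auto simp: admissible_def V_perp_def blinfun.diff_right)

lemma admissible_mono: "S \<subseteq> T \<Longrightarrow> admissible I A \<phi> S i \<alpha> \<subseteq> admissible I A \<phi> T i \<alpha>"
  by (auto simp: admissible_def)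

lemma closed_admissible: "closed S \<Longrightarrow> closed (admissible I A \<phi> S i \<alpha>)"
proof -
  have "admissible I A \<phi> S i \<alpha> = S \<inter> (\<Inter>j\<in>I. \<Inter>\<beta>\<in>A.
    {\<psi>. blinfun_apply (\<phi> j \<beta>) \<psi> = (if i = j \<and> \<alpha> = \<beta> then 1 else 0)})"
    by (auto simp: admissible_def)
  moreover assume "closed S"
  ultimately show ?thesis
    by (auto intro!: closed_INT closed_Int closed_Collect_eq continuous_intros)
qed

lemma admissible_midpoint:
  assumes "subspace S" "x \<in> admissible I A \<phi> S i \<alpha>" "y \<in> admissible I A \<phi> S i \<alpha>"
  shows "(1/2) *\<^sub>R (x + y) \<in> admissible I A \<phi> S i \<alpha>"
  using assms
  by (auto simp: admissible_def blinfun.add_right blinfun.scaleR_right subspace_add subspace_scale)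

text \<open>\<open>arg_min_on\<close> is a choice by \<open>SOME\<close>, so it has the minimizing
  property as soon as some minimizer exists.\<close>

lemma arg_min_on_ex:
  fixes f :: "'a \<Rightarrow> real"
  assumes "\<exists>x\<in>S. \<forall>y\<in>S. f x \<le> f y"
  shows "arg_min_on f S \<in> S" "y \<in> S \<Longrightarrow> f (arg_min_on f S) \<le> f y"
proof -
  have "\<exists>x. is_arg_min f (\<lambda>x. x \<in> S) x"
    using assms by (auto simp: is_arg_min_linorder)
  then have "is_arg_min f (\<lambda>x. x \<in> S) (arg_min_on f S)"
    unfolding arg_min_on_def arg_min_def by (rule someI_ex)
  then show "arg_min_on f S \<in> S" "y \<in> S \<Longrightarrow> f (arg_min_on f S) \<le> f y"
    by (auto simp: is_arg_min_linorder)
qed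

theorem theorem6p4:
  fixes Q :: "('b::banach \<Rightarrow>\<^sub>L real) \<Rightarrow> 'b"
    and N_beth N_aleph :: nat
    and beth aleph :: "nat set"
    and \<phi> :: "nat \<Rightarrow> nat \<Rightarrow> ('b \<Rightarrow>\<^sub>L real)"
    and \<B> :: "nat \<Rightarrow> 'b set"
    and i \<alpha> n :: nat
  assumes reflexive: "reflexive_space TYPE('b)"
    and separable: "separable_space (euclidean :: 'b topology)"
    and Q: "linear Q" "bij Q" "symmetric_positive_op Q"
    and norm_Q: "\<And>u. (norm u)\<^sup>2 = blinfun_apply (inv Q u) u"
    and index: "beth = {1..N_beth}" "aleph = {1..N_aleph}"
    and phi_inj: "inj_on (\<lambda>(j, \<beta>). \<phi> j \<beta>) (beth \<times> aleph)"
    and phi_indep: "independent ((\<lambda>(j, \<beta>). \<phi> j \<beta>) ` (beth \<times> aleph))"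
    and closed_subspaces: "\<And>j. j \<in> beth \<Longrightarrow> subspace (\<B> j) \<and> closed (\<B> j)"
    and sum_subspaces: "(\<Sum>j\<in>beth. \<B> j) = UNIV"
    and dual_elements: "\<And>j \<beta>. j \<in> beth \<Longrightarrow> \<beta> \<in> aleph \<Longrightarrow> \<exists>\<psi>. \<psi> \<in> admissible beth aleph \<phi> (\<B> j) j \<beta>"
    and lambda_min_pos:
      "lambda_min Q (V_perp beth aleph \<phi>) (subspace_op Q beth aleph \<phi> \<B>) > 0"
    and i: "i \<in> beth" and \<alpha>: "\<alpha> \<in> aleph"
    and minimizer_exists: "psi_loc_exists Q beth aleph \<phi> \<B> n i \<alpha>"
  shows "norm (psi beth aleph \<phi> i \<alpha> - psi_loc Q beth aleph \<phi> \<B> n i \<alpha>)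
    \<le> ((Cond Q (V_perp beth aleph \<phi>) (subspace_op Q beth aleph \<phi> \<B>) - 1) /
        (Cond Q (V_perp beth aleph \<phi>) (subspace_op Q beth aleph \<phi> \<B>) + 1)) ^ n
      * norm (psi_loc Q beth aleph \<phi> \<B> 0 i \<alpha>)"
proof -
  define V where "V = V_perp beth aleph \<phi>"
  define P where "P = subspace_op Q beth aleph \<phi> \<B>"
  define p where "p j = orth_proj Q (\<B> j \<inter> V)" for j
  define ip where "ip = Q_inner Q"
  define B where "B k = local_space Q beth \<B> k i" for k
  define adm where "adm S = admissible beth aleph \<phi> S i \<alpha>" for S
  define \<psi> where "\<psi> = psi beth aleph \<phi> i \<alpha>"
  define \<psi>l where "\<psi>l k = psi_loc Q beth aleph \<phi> \<B> k i \<alpha>" for k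
  define m where "m = lambda_min Q V P"
  define M where "M = lambda_max Q V P"
  interpret H: hilbert_form ip
    unfolding ip_def using Q norm_Q by (rule hilbert_form_Q_inner)
  have fin: "finite beth" using index by simp
  have sB: "subspace (\<B> j)" and cB: "closed (\<B> j)" if "j \<in> beth" for j
    using closed_subspaces that by auto
  have sV: "subspace V" and cV: "closed V"
    by (simp_all add: V_def subspace_V_perp closed_V_perp)
  have sBk: "subspace (B k)" for k
    unfolding B_def local_space_def using sB by (intro subspace_set_sum) auto

  have m: "0 < m" using lambda_min_pos by (simp add: m_def V_def P_def)

  \<comment> \<open>The projections and the form of \<open>P\<close>\<close>
  have P_eq: "P x = (\<Sum>j\<in>beth. p j x)" for x
    by (simp add: P_def subspace_op_def p_def V_def)
  have p: "p j x \<in> \<B> j \<inter> V \<and> (\<forall>z\<in>\<B> j \<inter> V. ip (x - p j x) z = 0)" if "j \<in> beth" for j x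
  proof -
    have "\<exists>!y. y \<in> \<B> j \<inter> V \<and> (\<forall>z\<in>\<B> j \<inter> V. ip (x - y) z = 0)"
      using that sB cB sV cV by (intro H.projection_ex1 closed_Int subspace_inter)
    from theI'[OF this] show ?thesis
      unfolding p_def orth_proj_def ip_def .
  qed
  have p_in: "p j x \<in> \<B> j" "p j x \<in> V" and p_orth: "z \<in> \<B> j \<inter> V \<Longrightarrow> ip (x - p j x) z = 0"
    if "j \<in> beth" for j x z
    using p[OF that] by blast+
  have lin_p: "linear (p j)" if "j \<in> beth" for j
    using that p sB sV by (intro H.projection_linear[of "\<B> j \<inter> V"] subspace_inter) blast+
  have lin_P: "linear P"
    unfolding P_eq[abs_def] using lin_p by (intro linear_compose_sum) blast
  have ip_p: "ip x (p j y) = ip (p j x) (p j y)" if "j \<in> beth" for j x y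
    using that p by (intro H.projection_ip[of "p j" "\<B> j \<inter> V"]) blast+
  have p_norm: "norm (p j x) \<le> norm x" if "j \<in> beth" for j x
    using that p by (intro H.projection_norm_le[of "p j" "\<B> j \<inter> V"]) blast+
  have sym_p: "ip (p j x) y = ip x (p j y)" if "j \<in> beth" for j x y
    using ip_p[OF that, of x y] ip_p[OF that, of y x] H.commute by metis
  have sym_P: "ip (P x) y = ip x (P y)" for x y
    by (simp add: P_eq H.sum_left H.sum_right sym_p)
  have P_in: "P x \<in> V" for x
    unfolding P_eq using p_in sV by (intro subspace_sum) auto
  have ip_p_self: "ip x (p j x) = (norm (p j x))\<^sup>2" if "j \<in> beth" for j x
    unfolding H.norm_sq using that by (rule ip_p)
  \<comment> \<open>As a sum of squares the form is nonnegative, and since projections do not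
    increase norms, \<open>card beth\<close> is an upper constant. These two facts are what the
    extremal constants need in order to exist on a nonzero \<open>V\<close>.\<close>
  have ip_P: "ip x (P x) = (\<Sum>j\<in>beth. (norm (p j x))\<^sup>2)" for x
    by (simp add: P_eq H.sum_right ip_p_self)
  have ip_P_nonneg: "0 \<le> ip x (P x)" for x
    by (simp add: ip_P sum_nonneg)
  have ip_P_le: "ip x (P x) \<le> real (card beth) * (norm x)\<^sup>2" for x
    unfolding ip_P using p_norm by (intro sum_bounded_above power_mono) auto

  have dual: "adm (\<B> i) \<noteq> {}"
    using dual_elements[OF i \<alpha>] by (auto simp: adm_def)
  have sub: "\<B> i \<subseteq> B k" for k
    using local_space_mono[where m = 0 and n = k and \<B> = \<B>] fin sB
    by (auto simp: B_def local_space_0[OF i, of Q \<B>, symmetric])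
  have adm_sub: "adm S \<subseteq> adm UNIV" for S
    unfolding adm_def by (rule admissible_mono) simp

  \<comment> \<open>The minimizers and their distances\<close>
  have \<psi>: "\<psi> \<in> adm UNIV" "\<And>y. y \<in> adm UNIV \<Longrightarrow> norm \<psi> \<le> norm y"
  proof -
    have "\<exists>x\<in>adm UNIV. \<forall>y\<in>adm UNIV. norm x \<le> norm y"
      using dual adm_sub[of "\<B> i"] unfolding adm_def
      by (intro H.norm_minimizer_exists closed_admissible admissible_midpoint) auto
    from arg_min_on_ex[OF this] show "\<psi> \<in> adm UNIV" "\<And>y. y \<in> adm UNIV \<Longrightarrow> norm \<psi> \<le> norm y"
      by (auto simp: \<psi>_def psi_def adm_def)
  qed
  have \<psi>l0: "\<psi>l 0 \<in> adm (\<B> i)"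
  proof -
    have "\<exists>x\<in>adm (\<B> i). \<forall>y\<in>adm (\<B> i). norm x \<le> norm y"
      using dual sB[OF i] cB[OF i] unfolding adm_def
      by (intro H.norm_minimizer_exists closed_admissible admissible_midpoint) auto
    from arg_min_on_ex(1)[OF this] show ?thesis
      by (simp add: \<psi>l_def psi_loc_def local_space_0[OF i] adm_def)
  qed
  \<comment> \<open>Here existence is taken from \<open>minimizer_exists\<close>: \<open>B n\<close>
    is a sum of closed subspaces and need not be closed, whereas \<open>UNIV\<close> and
    \<open>\<B> i\<close> are closed.\<close>
  have \<psi>ln: "\<psi>l n \<in> adm (B n)" "\<And>y. y \<in> adm (B n) \<Longrightarrow> norm (\<psi>l n) \<le> norm y"
  proof -
    have "\<exists>x\<in>adm (B n). \<forall>y\<in>adm (B n). norm x \<le> norm y"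
      using minimizer_exists by (auto simp: psi_loc_exists_def is_arg_min_linorder adm_def B_def)
    from arg_min_on_ex[OF this] show "\<psi>l n \<in> adm (B n)" "\<And>y. y \<in> adm (B n) \<Longrightarrow> norm (\<psi>l n) \<le> norm y"
      by (auto simp: \<psi>l_def psi_loc_def adm_def B_def)
  qed
  have adm_diff: "x - y \<in> V" if "x \<in> adm S" "y \<in> adm T" for x y S T
    using that unfolding adm_def V_def by (rule admissible_diff)

  have \<psi>_orth: "ip \<psi> v = 0" if "v \<in> V" for v
  proof (rule H.orthogonal_if_minimal)
    fix t
    have "\<psi> + t *\<^sub>R v \<in> adm UNIV"
      using \<psi>(1) that sV unfolding adm_def V_def
      by (intro admissible_add) (auto simp: subspace_scale)
    then show "norm \<psi> \<le> norm (\<psi> + t *\<^sub>R v)" by (rule \<psi>(2))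
  qed
  have pyth: "(norm y)\<^sup>2 = (norm \<psi>)\<^sup>2 + (norm (y - \<psi>))\<^sup>2" if "y \<in> adm S" for y S
    using H.pythagoras[of \<psi> "y - \<psi>"] \<psi>_orth[OF adm_diff[OF that \<psi>(1)]] by simp
  \<comment> \<open>By \<open>pyth\<close>, squared norm and squared distance to
    \<open>\<psi>\<close> differ by a constant on admissible elements, so both have the same
    minimizers.\<close>
  have best: "norm (\<psi> - \<psi>l n) \<le> norm (y - \<psi>)" if "y \<in> adm (B n)" for y
  proof -
    have "(norm (\<psi>l n))\<^sup>2 \<le> (norm y)\<^sup>2"
      using \<psi>ln(2)[OF that] by (simp add: power_mono)
    then have "(norm (\<psi>l n - \<psi>))\<^sup>2 \<le> (norm (y - \<psi>))\<^sup>2"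
      using pyth[OF that] pyth[OF \<psi>ln(1)] by simp
    then show ?thesis
      unfolding norm_minus_commute[of \<psi>] by (rule power2_le_imp_le) simp
  qed
  have init: "norm (\<psi>l 0 - \<psi>) \<le> norm (\<psi>l 0)"
    by (rule power2_le_imp_le) (simp_all add: pyth[OF \<psi>l0])

  \<comment> \<open>Contraction and spread of the iterates\<close>
  have "norm (\<psi> - \<psi>l n) \<le> ((M / m - 1) / (M / m + 1)) ^ n * norm (\<psi>l 0)"
  \<comment> \<open>On the trivial space the extremal constants are unspecified, but they agree, so
    the quotient is 1. All admissible elements coincide there and the left side is 0.\<close>
  proof (cases "V = {0}")
    case True
    have "M = m"
      unfolding M_def m_def True
      by (rule lambda_max_eq_lambda_min_trivial) (simp add: linear_0[OF lin_P] flip: ip_def)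
    moreover have "\<psi> - \<psi>l n = 0"
      using adm_diff[OF \<psi>(1) \<psi>ln(1)] True by simp
    ultimately show ?thesis using m by simp
  next
    case False
    then obtain v\<^sub>0 where v\<^sub>0: "v\<^sub>0 \<in> V" "v\<^sub>0 \<noteq> 0"
      using subspace_0[OF sV] by blast
    have lower: "m * (norm v)\<^sup>2 \<le> ip v (P v)" if "v \<in> V" for v
      unfolding m_def lambda_min_def ip_def[symmetric]
      by (rule Greatest_lower_constant[where v\<^sub>0 = v\<^sub>0]) (use v\<^sub>0 that ip_P_nonneg in auto)
    have upper: "ip v (P v) \<le> M * (norm v)\<^sup>2" if "v \<in> V" for v
      unfolding M_def lambda_max_def ip_def[symmetric]
      by (rule Least_upper_constant[where v\<^sub>0 = v\<^sub>0]) (use v\<^sub>0 that ip_P_le in auto)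
    have "m \<le> M"
      using order_trans[OF lower[OF v\<^sub>0(1)] upper[OF v\<^sub>0(1)]] v\<^sub>0(2) by simp
    define \<rho> where "\<rho> = (M - m) / (M + m)"
    have "M / m - 1 = (M - m) / m" "M / m + 1 = (M + m) / m"
      using m by (simp_all add: diff_divide_distrib add_divide_distrib)
    then have \<rho>: "0 \<le> \<rho>" "(M / m - 1) / (M / m + 1) = \<rho>"
      using m \<open>m \<le> M\<close> by (simp_all add: \<rho>_def)
    define step where "step x = x - (2 / (m + M)) *\<^sub>R P x" for x
    define x where "x k = (step ^^ k) (\<psi>l 0)" for k
    have x_Suc: "x (Suc k) = step (x k)" for k by (simp add: x_def)

    have step_adm: "step y \<in> adm (B (Suc k))" if y: "y \<in> adm (B k)" for y k
    proof -
      have yB: "y \<in> B k" using y by (simp add: adm_def admissible_def)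
      have mono: "B k \<subseteq> B (Suc k)"
        unfolding B_def using fin sB by (intro local_space_mono) auto
      \<comment> \<open>If \<open>j\<close> is within distance \<open>Suc k\<close> of
        \<open>i\<close>, then \<open>\<B> j\<close> is a summand of \<open>B (Suc k)\<close>.
        Otherwise \<open>j\<close> is not connected to any index contributing to \<open>y\<close>,
        and the projection of \<open>y\<close> vanishes.\<close>
      have "p j y \<in> B (Suc k)" if j: "j \<in> beth" for j
      proof (cases "graph_dist Q beth \<B> i j \<le> enat (Suc k)")
        case True
        then have "\<B> j \<subseteq> B (Suc k)"
          unfolding B_def local_space_def using fin sB j by (intro subset_set_sum) auto
        then show ?thesis using p_in[OF j] by blast
      next
        case False
        obtain s where s: "y = sum s {l\<in>beth. graph_dist Q beth \<B> i l \<le> enat k}"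
          "\<forall>l\<in>{l\<in>beth. graph_dist Q beth \<B> i l \<le> enat k}. s l \<in> \<B> l"
          using yB fin by (auto simp: B_def local_space_def set_sum_alt)
        have "ip (p j y) (s l) = 0" if l: "l \<in> {l\<in>beth. graph_dist Q beth \<B> i l \<le> enat k}" for l
        proof -
          \<comment> \<open>A connection from \<open>l\<close>, at distance at most
            \<open>k\<close>, would bring \<open>j\<close> within distance
            \<open>Suc k\<close>.\<close>
          have "conn Q \<B> l j = 0"
            using graph_dist_le_Suc[of Q beth \<B> i l k j] l j False by auto
          then show ?thesis
            using s(2) l p_in(1)[OF j] unfolding conn_def ip_def
            by (metis zero_neq_one)
        qed
        then have "ip (p j y) y = 0"
          unfolding s(1) H.sum_right by (simp flip: s(1))
        \<comment> \<open>Pairing \<open>y\<close> with its own projection gives the squared norm of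
          that projection.\<close>
        then have "(norm (p j y))\<^sup>2 = 0"
          using ip_p_self[OF j] H.commute by metis
        then show ?thesis using subspace_0[OF sBk] by simp
      qed
      then have "P y \<in> B (Suc k)"
        unfolding P_eq using sBk by (intro subspace_sum)
      moreover have "y \<in> adm (B (Suc k))"
        using y mono by (auto simp: adm_def admissible_def)
      ultimately have "y + (- (2 / (m + M))) *\<^sub>R P y \<in> adm (B (Suc k))"
        using P_in sV sBk unfolding adm_def V_def by (intro admissible_add subspace_scale)
      then show ?thesis by (simp add: step_def)
    qed
    have x_adm: "x k \<in> adm (B k)" for k
    proof (induction k)
      case 0
      show ?case using \<psi>l0 by (simp add: x_def B_def local_space_0[OF i])
    qed (simp add: x_Suc step_adm)

    have "p j \<psi> = 0" if "j \<in> beth" for j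
      using ip_p_self[OF that, of \<psi>] \<psi>_orth[OF p_in(2)[OF that]] by simp
    then have P\<psi>: "P \<psi> = 0" by (simp add: P_eq)
    have "norm (x k - \<psi>) \<le> \<rho> ^ k * norm (\<psi>l 0)" for k
    proof (induction k)
      case (Suc k)
      \<comment> \<open>Since \<open>P \<psi> = 0\<close>, \<open>\<psi>\<close> is a fixed point of
        \<open>step\<close>, and the error obeys the same recursion. As a difference of admissible
        elements it lies in \<open>V\<close>, where the bounds \<open>m\<close> and \<open>M\<close>
        hold.\<close>
      have "x (Suc k) - \<psi> = (x k - \<psi>) - (2 / (m + M)) *\<^sub>R P (x k - \<psi>)"
        by (simp add: x_Suc step_def linear_diff[OF lin_P] P\<psi>)
      then have "norm (x (Suc k) - \<psi>) \<le> \<rho> * norm (x k - \<psi>)"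
        using H.richardson_contraction[OF sV lin_P P_in sym_P lower upper m \<open>m \<le> M\<close>
            adm_diff[OF x_adm \<psi>(1)]] by (simp only: \<rho>_def)
      also have "\<dots> \<le> \<rho> * (\<rho> ^ k * norm (\<psi>l 0))"
        using Suc \<rho>(1) by (rule mult_left_mono)
      finally show ?case by simp
    qed (use init in \<open>simp add: x_def\<close>)
    then show ?thesis
      using best[OF x_adm] \<rho>(2) order_trans by metis
  qed
  then show ?thesis
    by (simp add: \<psi>_def \<psi>l_def Cond_def M_def m_def V_def P_def)
qed

end
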